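(* Let $A$ be a normal operator on $\mathbb{C}^d$, let $L$ be a positive finite number, and let $\mathcal{G}\subset\mathbb{C}^d$ be a countable set of vectors. Let $M=\mathrm{Range}(A^* )$ and $P_M\mathcal{G}=\{P_Mg\}_{g\in\mathcal{G}}$, where $P_M$ is the orthogonal projection on $M$. Then $\{A^tg\}_{g\in\mathcal{G},\,t\in[0,L]}$ is a Bessel system in $\mathbb{C}^d$ if and only if $P_M\mathcal{G}$ is a Bessel system in $M$.
   Context: The family $P_M\mathcal{G}=\{P_Mg\}_{g\in\mathcal{G}}$ (indexed by $g\in\mathcal{G}$, so counted with repetition) is a Bessel system in $M$ if there is $C>0$ with $\sum_{g\in\mathcal{G}}|\langle f,P_Mg\rangle|^2\le C\|f\|^2$ for all $f\in M$. $\{A^tg\}_{g\in\mathcal{G},t\in[0,L]}$ is a Bessel system in $\mathbb{C}^d$ if there is $C>0$ with $\sum_{g\in\mathcal{G}}\int_0^L|\langle f,A^tg\rangle|^2dt\le C\|f\|^2$ for all $f\in\mathbb{C}^d$. For a normal operator $A$ with spectral measure $E$, $A^t=\int_{\sigma(A)}z^t\,dE(z)$ (in finite dimensions, $A^t=\sum_i\lambda_i^tP_i$ over the spectral decomposition of $A$), where $z^t=\exp(t(\ln|z|+i\arg z))$ with $\arg z\in[-\pi,\pi)$ for $z\ne0$, and $0^t=0$ for $t>0$, $0^0=1$. *)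

theory Defs
  imports "HOL-Analysis.Analysis"
begin

definition cinner :: "complex ^ 'n \<Rightarrow> complex ^ 'n \<Rightarrow> complex"
  where "cinner f g = (\<Sum>i\<in>UNIV. f $ i * cnj (g $ i))"

definition conj_transpose :: "complex ^ 'n ^ 'm \<Rightarrow> complex ^ 'm ^ 'n"
  where "conj_transpose A = (\<chi> i j. cnj (A $ j $ i))"

definition normal_matrix :: "complex ^ 'n ^ 'n \<Rightarrow> bool"
  where "normal_matrix A \<longleftrightarrow> A ** conj_transpose A = conj_transpose A ** A"

text \<open>The orthogonal projection onto \<open>M\<close>, meaningful when \<open>M\<close> is a complex linear subspace.\<close>

definition orth_proj :: "(complex ^ 'n) set \<Rightarrow> complex ^ 'n \<Rightarrow> complex ^ 'n"
  where "orth_proj M x = (THE y. y \<in> M \<and> (\<forall>z\<in>M. cinner (x - y) z = 0))"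

definition eigenspace :: "complex ^ 'n ^ 'n \<Rightarrow> complex \<Rightarrow> (complex ^ 'n) set"
  where "eigenspace A z = {v. A *v v = z *s v}"

definition eigenvalues :: "complex ^ 'n ^ 'n \<Rightarrow> complex set"
  where "eigenvalues A = {z. \<exists>v. v \<noteq> 0 \<and> A *v v = z *s v}"

text \<open>The argument with values in \<open>[-\<pi>, \<pi>)\<close>; the library's \<^const>\<open>Arg\<close> takes values in
  \<open>(-\<pi>, \<pi>]\<close>, so the two differ on the negative real axis. For the same reason \<open>z\<^sup>t\<close> below is not
  the library's complex \<open>powr\<close>.\<close>

definition arg_lower :: "complex \<Rightarrow> real"
  where "arg_lower z = (if Arg z = pi then - pi else Arg z)"

definition cpow :: "complex \<Rightarrow> real \<Rightarrow> complex"
  where "cpow z t =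
    (if z = 0 then (if t = 0 then 1 else 0)
     else exp (of_real t * (of_real (ln (cmod z)) + \<i> * of_real (arg_lower z))))"

text \<open>\<open>A\<^sup>t x\<close> for normal \<open>A\<close>: the integral of \<open>z\<^sup>t\<close> against the spectral measure, which in finite
  dimension is the sum of the point masses at the eigenvalues, i.e. of the orthogonal
  projections onto the eigenspaces. The set of eigenvalues is finite.\<close>

definition normal_power :: "complex ^ 'n ^ 'n \<Rightarrow> real \<Rightarrow> complex ^ 'n \<Rightarrow> complex ^ 'n"
  where "normal_power A t x =
    (\<Sum>z\<in>eigenvalues A. cpow z t *s orth_proj (eigenspace A z) x)"

text \<open>Sums and integrals are taken in \<^typ>\<open>ennreal\<close>, so that the bounds include convergence.\<close>

definition bessel_system :: "(complex ^ 'n) set \<Rightarrow> 'i set \<Rightarrow> ('i \<Rightarrow> complex ^ 'n) \<Rightarrow> bool"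
  where "bessel_system M I \<phi> \<longleftrightarrow>
    (\<exists>C>0. \<forall>f\<in>M.
      (\<Sum>\<^sub>\<infinity>i\<in>I. ennreal ((cmod (cinner f (\<phi> i)))\<^sup>2)) \<le> ennreal (C * (norm f)\<^sup>2))"

definition semicontinuous_bessel_system ::
    "(complex ^ 'n) set \<Rightarrow> 'i set \<Rightarrow> real \<Rightarrow> ('i \<Rightarrow> real \<Rightarrow> complex ^ 'n) \<Rightarrow> bool"
  where "semicontinuous_bessel_system M I L \<phi> \<longleftrightarrow>
    (\<exists>C>0. \<forall>f\<in>M.
      (\<Sum>\<^sub>\<infinity>i\<in>I. \<integral>\<^sup>+t\<in>{0..L}. ennreal ((cmod (cinner f (\<phi> i t)))\<^sup>2) \<partial>lborel)
        \<le> ennreal (C * (norm f)\<^sup>2))"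

end

theory Submission
  imports Defs "HOL-Computational_Algebra.Fundamental_Theorem_Algebra"
begin

text \<open>Both conditions are equivalent to a bound
  \<open>\<Sum>\<^sub>g |\<langle>P\<^sub>z f, g\<rangle>|\<^sup>2 \<le> C \<parallel>f\<parallel>\<^sup>2\<close> for every nonzero eigenvalue \<open>z\<close>,
  where \<open>P\<^sub>z\<close> is the spectral projection: the range of \<open>A\<^sup>*\<close> is the orthogonal sum
  of the eigenspaces for nonzero eigenvalues, of which there are finitely many, and \<open>|z\<^sup>t|\<^sup>2\<close>
  is bounded above and away from \<open>0\<close> for \<open>t \<in> [0, L]\<close>. The kernel of \<open>A\<close> contributes only
  at \<open>t = 0\<close>, a null set.\<close>

section \<open>The Hermitian inner product and the adjoint matrix\<close>

lemma cinner_add_left: "cinner (x + y) z = cinner x z + cinner y z"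
  by (simp add: cinner_def sum.distrib algebra_simps)

lemma cinner_add_right: "cinner x (y + z) = cinner x y + cinner x z"
  by (simp add: cinner_def sum.distrib algebra_simps)

lemma cinner_diff_left: "cinner (x - y) z = cinner x z - cinner y z"
  by (simp add: cinner_def sum_subtractf algebra_simps)

lemma cinner_diff_right: "cinner x (y - z) = cinner x y - cinner x z"
  by (simp add: cinner_def sum_subtractf algebra_simps)

lemma cinner_scale_left: "cinner (c *s x) y = c * cinner x y"
  by (simp add: cinner_def sum_distrib_left mult.assoc)

lemma cinner_scale_right: "cinner x (c *s y) = cnj c * cinner x y"
  by (simp add: cinner_def sum_distrib_left mult_ac)

lemma cinner_zero_left [simp]: "cinner 0 x = 0"
  by (simp add: cinner_def)

lemma cinner_zero_right [simp]: "cinner x 0 = 0"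
  by (simp add: cinner_def)

lemma cinner_sum_left: "cinner (\<Sum>i\<in>I. f i) x = (\<Sum>i\<in>I. cinner (f i) x)"
  by (induction I rule: infinite_finite_induct) (auto simp: cinner_add_left)

lemma cinner_commute: "cinner x y = cnj (cinner y x)"
  by (simp add: cinner_def mult.commute)

lemma cinner_sum_right: "cinner x (\<Sum>i\<in>I. f i) = (\<Sum>i\<in>I. cinner x (f i))"
  by (induction I rule: infinite_finite_induct) (auto simp: cinner_add_right)

lemma inner_eq_Re_cinner: "x \<bullet> y = Re (cinner x y)"
  by (simp add: cinner_def inner_vec_def inner_complex_def)

lemma cinner_self: "cinner x x = of_real ((norm x)\<^sup>2)"
proof (rule complex_eqI)
  show "Re (cinner x x) = Re (of_real ((norm x)\<^sup>2))"
    by (simp add: inner_eq_Re_cinner[symmetric] power2_norm_eq_inner)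
  have "Im (cinner x x) = Im (cnj (cinner x x))"
    by (subst cinner_commute) simp
  then show "Im (cinner x x) = Im (of_real ((norm x)\<^sup>2))"
    by simp
qed

lemma cinner_self_eq_0_iff [simp]: "cinner x x = 0 \<longleftrightarrow> x = 0"
  by (simp add: cinner_self)

lemma cinner_matrix_left: "cinner (A *v x) y = cinner x (conj_transpose A *v y)"
proof -
  have "cinner (A *v x) y = (\<Sum>i\<in>UNIV. \<Sum>j\<in>UNIV. A $ i $ j * x $ j * cnj (y $ i))"
    by (simp add: cinner_def matrix_vector_mult_def sum_distrib_right)
  also have "\<dots> = (\<Sum>j\<in>UNIV. \<Sum>i\<in>UNIV. A $ i $ j * x $ j * cnj (y $ i))"
    by (rule sum.swap)
  finally show ?thesis
    by (simp add: cinner_def matrix_vector_mult_def conj_transpose_def sum_distrib_left mult_ac)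
qed

lemma cinner_matrix_right: "cinner x (A *v y) = cinner (conj_transpose A *v x) y"
  by (metis cinner_commute cinner_matrix_left)

section \<open>Eigenvectors of a normal matrix\<close>

text \<open>Normality makes \<open>A *v v\<close> and its adjoint counterpart equally long, so all
  terms cancel in the expansion of the squared norm of the difference of the two sides.\<close>

lemma conj_transpose_eigenvector:
  assumes "normal_matrix A" and Av: "A *v v = z *s v"
  shows "conj_transpose A *v v = cnj z *s v"
proof -
  let ?B = "conj_transpose A"
  have "cinner (?B *v v) (?B *v v) = cinner v ((A ** ?B) *v v)"
    by (simp add: cinner_matrix_right matrix_vector_mul_assoc[symmetric])
  also have "\<dots> = cinner v ((?B ** A) *v v)"
    using assms(1) by (simp add: normal_matrix_def)
  also have "\<dots> = cinner (A *v v) (A *v v)"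
    by (simp add: cinner_matrix_left matrix_vector_mul_assoc[symmetric])
  also have "\<dots> = z * cnj z * cinner v v"
    by (simp add: Av cinner_scale_left cinner_scale_right)
  finally have 1: "cinner (?B *v v) (?B *v v) = z * cnj z * cinner v v" .
  have 2: "cinner (?B *v v) v = cnj z * cinner v v"
    by (simp add: cinner_matrix_right[symmetric] Av cinner_scale_right)
  have 3: "cinner v (?B *v v) = z * cinner v v"
    by (simp add: cinner_matrix_left[symmetric] Av cinner_scale_left)
  have "cinner (?B *v v - cnj z *s v) (?B *v v - cnj z *s v) = 0"
    by (simp add: cinner_diff_left cinner_diff_right cinner_scale_left cinner_scale_right
        1 2 3 algebra_simps)
  then show ?thesis
    by simp
qed

text \<open>Moving \<open>A\<close> across the inner product as its adjoint turns the factor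
  \<open>z\<close> into \<open>w\<close>, since \<open>u\<close> is an eigenvector of the adjoint
  for \<open>cnj w\<close>.\<close>

lemma eigenvectors_orthogonal:
  assumes "normal_matrix A" "A *v v = z *s v" "A *v u = w *s u" "z \<noteq> w"
  shows "cinner v u = 0"
proof -
  have "z * cinner v u = cinner (A *v v) u"
    by (simp add: assms(2) cinner_scale_left)
  also have "\<dots> = w * cinner v u"
    by (simp add: cinner_matrix_left conj_transpose_eigenvector[OF assms(1,3)] cinner_scale_right)
  finally show ?thesis
    using \<open>z \<noteq> w\<close> by simp
qed

text \<open>The vector y = (A - z) x is killed by A - z, hence also by its adjoint, and therefore
  <y, y> = <x, (A - z)^* y> = 0.\<close>

lemma normal_generalized_eigenvector:
  assumes "normal_matrix A" and y: "A *v (A *v x - z *s x) = z *s (A *v x - z *s x)"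
  shows "A *v x = z *s x"
proof -
  let ?y = "A *v x - z *s x"
  have "cinner ?y ?y = cinner x (conj_transpose A *v ?y) - z * cinner x ?y"
    by (simp add: cinner_diff_left[of _ _ ?y] cinner_matrix_left cinner_scale_left)
  also have "\<dots> = 0"
    by (simp only: conj_transpose_eigenvector[OF assms] cinner_scale_right complex_cnj_cnj diff_self)
  finally show ?thesis
    by simp
qed

text \<open>One eigenvector chosen per eigenvalue gives nonzero, pairwise orthogonal vectors; these
  are linearly independent over the reals, so there are finitely many.\<close>

lemma finite_eigenvalues:
  assumes "normal_matrix A"
  shows "finite (eigenvalues A)"
proof -
  have "\<forall>z\<in>eigenvalues A. \<exists>v. v \<noteq> 0 \<and> A *v v = z *s v"
    by (simp add: eigenvalues_def)
  from bchoice[OF this] obtain e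
    where e: "\<And>z. z \<in> eigenvalues A \<Longrightarrow> e z \<noteq> 0 \<and> A *v e z = z *s e z"
    by blast
  have orth: "cinner (e z) (e w) = 0" if "z \<in> eigenvalues A" "w \<in> eigenvalues A" "z \<noteq> w" for z w
    using eigenvectors_orthogonal[OF assms] e that by blast
  have inj: "inj_on e (eigenvalues A)"
    by (rule inj_onI) (metis cinner_self_eq_0_iff e orth)
  have "independent (e ` eigenvalues A)"
  proof (rule pairwise_orthogonal_independent)
    show "pairwise orthogonal (e ` eigenvalues A)"
      unfolding pairwise_def orthogonal_def inner_eq_Re_cinner using orth by fastforce
    show "0 \<notin> e ` eigenvalues A"
      using e by force
  qed
  then have "finite (e ` eigenvalues A)"
    by (rule independent_imp_finite)
  then show ?thesis
    using inj finite_imageD by blast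
qed

section \<open>Spanning by eigenvectors, through polynomials in a matrix\<close>

text \<open>This is the vector p(A) x, formed from the iterates of \<open>x\<close> under
  \<open>A\<close>, so that only vectors and no powers of matrices occur.\<close>

definition poly_apply :: "complex ^ 'n ^ 'n \<Rightarrow> complex poly \<Rightarrow> complex ^ 'n \<Rightarrow> complex ^ 'n"
  where "poly_apply A p x = (\<Sum>i\<le>degree p. coeff p i *s ((*v) A ^^ i) x)"

lemma poly_apply_altdef:
  assumes "degree p \<le> n"
  shows "poly_apply A p x = (\<Sum>i\<le>n. coeff p i *s ((*v) A ^^ i) x)"
  unfolding poly_apply_def
  by (rule sum.mono_neutral_left) (use assms in \<open>auto simp: coeff_eq_0\<close>)

lemma matrix_power_diff:
  "((*v) A ^^ i) (A *v x - z *s x) = ((*v) A ^^ Suc i) x - z *s ((*v) A ^^ i) (x :: complex ^ 'n)"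
  by (induction i) (simp_all add: vec.diff vec.scale)

text \<open>Lets a root of an annihilating polynomial be traded for the replacement of
  \<open>x\<close> by (A - z) x, which drives the induction on the degree.\<close>

lemma poly_apply_linear_factor:
  "poly_apply A ([:- z, 1:] * q) x = poly_apply A q (A *v x - z *s x)"
proof -
  let ?n = "degree q" and ?f = "\<lambda>i. ((*v) A ^^ i) x"
  have "degree ([:- z, 1:] * q) \<le> Suc ?n"
    by (rule order.trans[OF degree_mult_le]) simp
  then have "poly_apply A ([:- z, 1:] * q) x
      = (\<Sum>i\<le>Suc ?n. coeff ([:- z, 1:] * q) i *s ?f i)"
    by (rule poly_apply_altdef)
  \<comment> \<open>Multiplication by X - z shifts the coefficients of \<open>q\<close> and
    subtracts \<open>z\<close> times them.\<close>
  also have "\<dots> = (\<Sum>i\<le>Suc ?n. coeff (pCons 0 q) i *s ?f i) - (\<Sum>i\<le>Suc ?n. coeff q i *s (z *s ?f i))"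
    by (simp add: sum_subtractf[symmetric] vec.scale_left_diff_distrib mult.commute del: sum.atMost_Suc)
  also have "(\<Sum>i\<le>Suc ?n. coeff (pCons 0 q) i *s ?f i) = (\<Sum>i\<le>?n. coeff q i *s ?f (Suc i))"
    by (subst sum.atMost_Suc_shift) simp
  also have "(\<Sum>i\<le>Suc ?n. coeff q i *s (z *s ?f i)) = (\<Sum>i\<le>?n. coeff q i *s (z *s ?f i))"
    by (simp add: coeff_eq_0)
  finally show ?thesis
    unfolding poly_apply_def matrix_power_diff
    by (simp only: sum_subtractf vec.scale_right_diff_distrib)
qed

lemma annihilating_polynomial:
  fixes A :: "complex ^ 'n ^ 'n"
  shows "\<exists>p. p \<noteq> 0 \<and> poly_apply A p x = 0"
proof -
  let ?f = "\<lambda>i. ((*v) A ^^ i) x" and ?n = "vec.dimension TYPE(complex) TYPE('n)"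
  \<comment> \<open>A repeated iterate is invisible in the set of iterates, so it is treated apart;
    it yields the polynomial X^j - X^i.\<close>
  consider i j where "i < j" "?f i = ?f j" | "inj_on ?f {..?n}"
    unfolding inj_on_def by (metis nat_neq_iff)
  then show ?thesis
  proof cases
    case 1
    let ?p = "monom 1 j - monom (1::complex) i"
    have c: "coeff ?p j = 1"
      using 1 by simp
    have "degree ?p \<le> j"
      using 1 by (intro degree_diff_le) (auto simp: degree_monom_eq)
    then have "poly_apply A ?p x = (\<Sum>k\<le>j. coeff ?p k *s ?f k)"
      by (rule poly_apply_altdef)
    also have "\<dots> = (\<Sum>k\<le>j. (if k = j then ?f k else 0) - (if k = i then ?f k else 0))"
      by (rule sum.cong) auto
    also have "\<dots> = 0"
      using 1 by (simp add: sum_subtractf)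
    finally show ?thesis
      using c by (metis coeff_0 zero_neq_one)
  next
    case 2
    \<comment> \<open>The range \<open>{..?n}\<close> includes both ends, so the distinct iterates
      outnumber the dimension by one.\<close>
    have "vec.dependent (?f ` {..?n})"
    proof (rule vec.dependent_biggerset_general)
      show "vec.dim (?f ` {..?n}) < card (?f ` {..?n})"
        using vec.dim_subset_UNIV[of "?f ` {..?n}"] by (simp add: card_image[OF 2])
    qed
    then obtain c v where v: "v \<in> ?f ` {..?n}" "c v \<noteq> 0" and c: "(\<Sum>v\<in>?f ` {..?n}. c v *s v) = 0"
      by (auto simp: vec.dependent_finite)
    let ?p = "\<Sum>i\<le>?n. monom (c (?f i)) i"
    have coeff: "coeff ?p k = (if k \<le> ?n then c (?f k) else 0)" for k
      by (simp add: coeff_sum)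
    have "degree ?p \<le> ?n"
      by (rule degree_le) (simp add: coeff)
    then have "poly_apply A ?p x = (\<Sum>i\<le>?n. coeff ?p i *s ?f i)"
      by (rule poly_apply_altdef)
    also have "\<dots> = (\<Sum>i\<le>?n. c (?f i) *s ?f i)"
      by (rule sum.cong) (auto simp: coeff)
    also have "\<dots> = 0"
      using c by (simp add: sum.reindex[OF 2])
    finally have "poly_apply A ?p x = 0" .
    moreover have "?p \<noteq> 0"
      using v coeff by (metis (no_types, lifting) atMost_iff coeff_0 imageE)
    ultimately show ?thesis
      by blast
  qed
qed

text \<open>Normality removes a single factor \<open>A - z\<close>: a component of \<open>(A - z) x\<close> in an eigenspace of
  \<open>w \<noteq> z\<close> is divided by \<open>w - z\<close>, and the remaining part of \<open>x\<close> is a generalized eigenvector.\<close>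

lemma span_eigenvectors_lift:
  assumes "normal_matrix A" and y: "A *v x - z *s x \<in> vec.span {v. \<exists>w. A *v v = w *s v}"
  shows "x \<in> vec.span {v. \<exists>w. A *v v = w *s v}" (is "_ \<in> vec.span ?E")
proof -
  \<comment> \<open>\<open>?Q\<close> says that a vector is (A - z) x' plus an eigenvector for
    \<open>z\<close>, with x' in the span; the second summand absorbs what A - z cannot
    reach.\<close>
  let ?Q = "\<lambda>y. \<exists>x'\<in>vec.span ?E. \<exists>v. A *v v = z *s v \<and> A *v x' - z *s x' + v = y"
  have "?Q (A *v x - z *s x)"
    using y
  proof (induction rule: vec.span_induct_alt)
    case base
    show ?case
      by (intro bexI[of _ 0] exI[of _ 0]) (auto simp: vec.span_zero)
  next
    case (step c u y)
    from step.hyps obtain w where w: "A *v u = w *s u"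
      by blast
    from step.IH obtain x' v where x': "x' \<in> vec.span ?E" and v: "A *v v = z *s v"
      and y: "A *v x' - z *s x' + v = y"
      by blast
    show ?case
    proof (cases "w = z")
      case True
      then show ?thesis
        using x' v y w by (intro bexI[of _ x'] exI[of _ "c *s u + v"])
          (auto simp: vec.add vec.scale vec.scale_right_distrib mult.commute)
    next
      case False
      let ?u = "(c / (w - z)) *s u"
      have "A *v ?u - z *s ?u = (c / (w - z) * (w - z)) *s u"
        by (simp only: vec.scale w vec.scale_scale vec.scale_left_diff_distrib right_diff_distrib)
          (simp add: mult.commute)
      then have "A *v ?u - z *s ?u = c *s u"
        using False by simp
      moreover have "?u + x' \<in> vec.span ?E"
        using x' step.hyps by (intro vec.span_add vec.span_scale) (auto intro: vec.span_base)
      ultimately show ?thesis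
        using y v by (intro bexI[of _ "?u + x'"] exI[of _ v])
          (auto simp: vec.add vec.scale_right_distrib algebra_simps)
    qed
  qed
  then obtain x' v where x': "x' \<in> vec.span ?E" and v: "A *v v = z *s v"
    and eq: "A *v x' - z *s x' + v = A *v x - z *s x"
    by blast
  \<comment> \<open>The vector x - x' is thus a generalized eigenvector for \<open>z\<close>, and
    normality makes it a genuine one.\<close>
  have "A *v (x - x') - z *s (x - x') = v"
    using eq by (simp add: vec.diff vec.scale_right_diff_distrib algebra_simps)
  then have "A *v (x - x') = z *s (x - x')"
    using normal_generalized_eigenvector[OF assms(1)] v by metis
  then have "x - x' \<in> vec.span ?E"
    by (intro vec.span_base) blast
  with x' have "x' + (x - x') \<in> vec.span ?E"
    by (rule vec.span_add)
  then show ?thesis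
    by simp
qed

text \<open>Induction on the degree of an annihilating polynomial of \<open>x\<close>: a nonzero
  constant forces x = 0; otherwise a complex root \<open>z\<close> splits off, the cofactor
  annihilates (A - z) x, and membership in the span lifts back to \<open>x\<close>.\<close>

lemma span_eigenvectors:
  assumes "normal_matrix A"
  shows "x \<in> vec.span {v. \<exists>w. A *v v = w *s v}"
proof -
  obtain p where "p \<noteq> 0" "poly_apply A p x = 0"
    using annihilating_polynomial by blast
  then show ?thesis
  proof (induction "degree p" arbitrary: p x)
    case 0
    then obtain c where "p = [:c:]" "c \<noteq> 0"
      by (metis degree_eq_zeroE pCons_0_0)
    then have "x = 0"
      using 0 by (simp add: poly_apply_def)
    then show ?case
      by (simp add: vec.span_zero)
  next
    case (Suc n)
    then have "\<not> constant (poly p)"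
      by (simp add: constant_degree)
    then obtain z where "poly p z = 0"
      using fundamental_theorem_of_algebra by blast
    then obtain q where q: "p = [:- z, 1:] * q"
      by (metis dvdE poly_eq_0_iff_dvd)
    with Suc.prems have "q \<noteq> 0" "poly_apply A q (A *v x - z *s x) = 0"
      by (auto simp only: poly_apply_linear_factor mult_zero_right)
    moreover have "n = degree q"
      using Suc.hyps(2) \<open>q \<noteq> 0\<close> by (simp add: q degree_mult_eq del: mult_pCons_left)
    ultimately show ?case
      using Suc.hyps(1) span_eigenvectors_lift[OF assms] by blast
  qed
qed

section \<open>Orthogonal projections onto complex subspaces\<close>

lemma orth_proj_eqI:
  assumes M: "vec.subspace M" "y \<in> M" "\<And>z. z \<in> M \<Longrightarrow> cinner (x - y) z = 0"
  shows "orth_proj M x = y"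
  unfolding orth_proj_def
proof (rule the_equality)
  show "y \<in> M \<and> (\<forall>z\<in>M. cinner (x - y) z = 0)"
    using M by blast
  fix y' assume y': "y' \<in> M \<and> (\<forall>z\<in>M. cinner (x - y') z = 0)"
  then have "y - y' \<in> M"
    using M vec.subspace_diff by blast
  then have "cinner ((x - y') - (x - y)) (y - y') = 0"
    using M(3) y' by (simp only: cinner_diff_left[of "x - y'"]) simp
  then have "y - y' = 0"
    by simp
  then show "y' = y"
    by simp
qed

text \<open>Makes the orthogonal decomposition for real subspaces applicable to complex
  ones.\<close>

lemma subspace_if_vec_subspace:
  assumes "vec.subspace (M :: (complex ^ 'n) set)"
  shows "subspace M"
proof (rule subspaceI)
  fix c :: real and x :: "complex ^ 'n"
  assume "x \<in> M"
  then have "of_real c *s x \<in> M"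
    using assms by (rule vec.subspace_scale[rotated])
  also have "of_real c *s x = c *\<^sub>R x"
    by (simp add: vec_eq_iff scaleR_conv_of_real[where ?'a = complex])
  finally show "c *\<^sub>R x \<in> M" .
qed (use assms vec.subspace_0 vec.subspace_add in blast)+

lemma orth_proj:
  fixes M :: "(complex ^ 'n) set"
  assumes "vec.subspace M"
  shows orth_proj_in: "orth_proj M x \<in> M"
    and cinner_orth_proj_residual: "z \<in> M \<Longrightarrow> cinner (x - orth_proj M x) z = 0"
proof -
  have span: "span M = M"
    using assms by (simp add: subspace_if_vec_subspace)
  obtain y r where y: "y \<in> M" and r: "\<And>w. w \<in> M \<Longrightarrow> orthogonal r w" and x: "x = y + r"
    using orthogonal_subspace_decomp_exists[of M x] unfolding span by metis
  have "cinner (x - y) w = 0" if "w \<in> M" for w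
  proof (rule complex_eqI)
    \<comment> \<open>Real orthogonality only controls the real part of the inner product; testing
      against \<i> times \<open>w\<close> gives the imaginary part.\<close>
    have "\<i> *s w \<in> M"
      using assms that by (rule vec.subspace_scale)
    then show "Re (cinner (x - y) w) = Re 0" "Im (cinner (x - y) w) = Im 0"
      using r[of w] r[of "\<i> *s w"] that x
      by (simp_all add: orthogonal_def inner_eq_Re_cinner cinner_scale_right)
  qed
  moreover from this have "orth_proj M x = y"
    using assms y by (intro orth_proj_eqI)
  ultimately show "orth_proj M x \<in> M" "z \<in> M \<Longrightarrow> cinner (x - orth_proj M x) z = 0"
    using y by auto
qed

lemma cinner_orth_proj_right:
  assumes "vec.subspace M" "f \<in> M"
  shows "cinner f (orth_proj M g) = cinner f g"
proof -
  have "cinner f (g - orth_proj M g) = 0"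
    using cinner_orth_proj_residual[OF assms, of g] cinner_commute by (metis complex_cnj_zero)
  then show ?thesis
    by (simp add: cinner_diff_right)
qed

lemma cinner_orth_proj_swap:
  assumes "vec.subspace M"
  shows "cinner f (orth_proj M g) = cinner (orth_proj M f) g"
  using cinner_orth_proj_right[OF assms orth_proj_in[OF assms]] cinner_commute by metis

text \<open>The squared norm of the projection equals its inner product with \<open>x\<close>, to
  which Cauchy-Schwarz applies.\<close>

lemma norm_orth_proj_le:
  fixes x :: "complex ^ 'n"
  assumes "vec.subspace M"
  shows "norm (orth_proj M x) \<le> norm x"
proof -
  let ?p = "orth_proj M x"
  have "(norm ?p)\<^sup>2 = ?p \<bullet> x"
    unfolding power2_norm_eq_inner inner_eq_Re_cinner
    by (simp add: cinner_orth_proj_right[OF assms orth_proj_in[OF assms]])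
  also have "\<dots> \<le> norm ?p * norm x"
    by (rule norm_cauchy_schwarz)
  finally show ?thesis
    by (cases "?p = 0") (auto simp: power2_eq_square)
qed

section \<open>The spectral decomposition and the range of the adjoint\<close>

lemma subspace_eigenspace: "vec.subspace (eigenspace A z)"
  by (auto simp: vec.subspace_def eigenspace_def vec.add vec.scale vec.scale_right_distrib mult.commute)

lemma orth_proj_eigenspace_orthogonal:
  assumes "normal_matrix A" "v \<in> eigenspace A z" "z \<noteq> w"
  shows "cinner v (orth_proj (eigenspace A w) x) = 0"
  using eigenvectors_orthogonal[OF assms(1) _ _ \<open>z \<noteq> w\<close>] assms(2)
    orth_proj_in[OF subspace_eigenspace, of A w x]
  by (simp add: eigenspace_def)

text \<open>The residual is orthogonal to every eigenvector, hence to their span, which is the whole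
  space, and so to itself.\<close>

lemma sum_orth_proj_eigenspace:
  assumes "normal_matrix A"
  shows "(\<Sum>z\<in>eigenvalues A. orth_proj (eigenspace A z) x) = x"
proof -
  let ?y = "x - (\<Sum>z\<in>eigenvalues A. orth_proj (eigenspace A z) x)"
  have "cinner v ?y = 0" if "A *v v = z *s v" for v z
  proof (cases "v = 0")
    case False
    then have z: "z \<in> eigenvalues A"
      using that by (auto simp: eigenvalues_def)
    have v: "v \<in> eigenspace A z"
      using that by (simp add: eigenspace_def)
    have "cinner v (\<Sum>w\<in>eigenvalues A. orth_proj (eigenspace A w) x)
        = (\<Sum>w\<in>eigenvalues A. if w = z then cinner v (orth_proj (eigenspace A w) x) else 0)"
      unfolding cinner_sum_right
      by (rule sum.cong) (use orth_proj_eigenspace_orthogonal[OF assms v] in auto)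
    also have "\<dots> = cinner v x"
      using z by (simp add: finite_eigenvalues[OF assms] cinner_orth_proj_right[OF subspace_eigenspace v])
    finally show ?thesis
      by (simp add: cinner_diff_right)
  qed simp
  moreover have "vec.subspace {v. cinner v ?y = 0}"
    by (simp add: vec.subspace_def cinner_add_left cinner_scale_left)
  ultimately have "vec.span {v. \<exists>w. A *v v = w *s v} \<subseteq> {v. cinner v ?y = 0}"
    by (intro vec.span_minimal) auto
  then have "cinner ?y ?y = 0"
    using span_eigenvectors[OF assms] by blast
  then show ?thesis
    by simp
qed

lemma subspace_range_matrix: "vec.subspace (range (\<lambda>x. A *v x))"
  by (auto intro!: vec.subspace_image vec.subspace_UNIV)

text \<open>On this eigenspace the adjoint is multiplication by the invertible scalar
  \<open>cnj z\<close>.\<close>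

lemma eigenspace_subset_range_adjoint:
  assumes "normal_matrix A" "z \<noteq> 0"
  shows "eigenspace A z \<subseteq> range (\<lambda>x. conj_transpose A *v x)"
proof
  fix v assume "v \<in> eigenspace A z"
  then have "conj_transpose A *v v = cnj z *s v"
    using conj_transpose_eigenvector[OF assms(1)] by (simp add: eigenspace_def)
  then have "v = conj_transpose A *v ((1 / cnj z) *s v)"
    using \<open>z \<noteq> 0\<close> by (simp add: vec.scale)
  then show "v \<in> range (\<lambda>x. conj_transpose A *v x)"
    by blast
qed

text \<open>The range of the adjoint is orthogonal to the kernel of \<open>A\<close>, which is
  \<open>eigenspace A 0\<close>.\<close>

lemma orth_proj_kernel_range_adjoint:
  assumes "f \<in> range (\<lambda>x. conj_transpose A *v x)"
  shows "orth_proj (eigenspace A 0) f = 0"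
proof (rule orth_proj_eqI)
  fix v assume "v \<in> eigenspace A 0"
  then show "cinner (f - 0) v = 0"
    using assms by (auto simp: eigenspace_def cinner_matrix_right[symmetric])
qed (auto simp: subspace_eigenspace vec.subspace_0)

section \<open>Pointwise estimates for the powers of the matrix\<close>

lemma cmod_sum_squared_le:
  "(cmod (\<Sum>i\<in>I. f i))\<^sup>2 \<le> card I * (\<Sum>i\<in>I. (cmod (f i))\<^sup>2)"
proof -
  have "(cmod (\<Sum>i\<in>I. f i))\<^sup>2 \<le> (\<Sum>i\<in>I. cmod (f i))\<^sup>2"
    by (intro power_mono norm_sum) simp
  also have "\<dots> \<le> (\<Sum>i\<in>I. (cmod (f i))\<^sup>2) * card I"
    by (rule sum_squared_le_sum_of_squares)
  finally show ?thesis
    by (simp add: mult.commute)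
qed

text \<open>The argument of \<open>z\<close> contributes only a factor of modulus one, leaving exp
  (2 t ln |z|). Summing the absolute logarithms over \<open>Z\<close> gives one bound for all
  nonzero \<open>z\<close> in \<open>Z\<close>.\<close>

lemma cmod_cpow_bounds:
  assumes "finite Z" "z \<in> Z" "z \<noteq> 0" "0 \<le> t" "t \<le> L"
  defines "B \<equiv> exp (2 * (L * (\<Sum>z\<in>Z. \<bar>ln (cmod z)\<bar>)))"
  shows "1 / B \<le> (cmod (cpow z t))\<^sup>2" "(cmod (cpow z t))\<^sup>2 \<le> B"
proof -
  let ?S = "\<Sum>z\<in>Z. \<bar>ln (cmod z)\<bar>"
  have "\<bar>ln (cmod z)\<bar> \<le> ?S"
    using assms by (intro member_le_sum) auto
  then have "\<bar>t * ln (cmod z)\<bar> \<le> L * ?S"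
    using assms by (auto simp: abs_mult intro!: mult_mono)
  moreover have "(cmod (cpow z t))\<^sup>2 = exp (2 * (t * ln (cmod z)))"
    using \<open>z \<noteq> 0\<close> by (simp add: cpow_def exp_double)
  moreover have "1 / B = exp (- (2 * (L * ?S)))"
    by (simp add: B_def exp_minus inverse_eq_divide)
  ultimately show "1 / B \<le> (cmod (cpow z t))\<^sup>2" "(cmod (cpow z t))\<^sup>2 \<le> B"
    unfolding B_def by (simp_all add: abs_le_iff)
qed

text \<open>All other spectral components are orthogonal to \<open>v\<close>. Being an equality,
  this also serves for lower bounds.\<close>

lemma cinner_normal_power_eigenspace:
  assumes "normal_matrix A" "z \<in> eigenvalues A" "v \<in> eigenspace A z"
  shows "cinner v (normal_power A t g) = cnj (cpow z t) * cinner v g"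
proof -
  have "cinner v (normal_power A t g)
      = (\<Sum>w\<in>eigenvalues A. if w = z then cnj (cpow w t) * cinner v (orth_proj (eigenspace A w) g) else 0)"
    unfolding normal_power_def cinner_sum_right cinner_scale_right
    by (rule sum.cong) (use orth_proj_eigenspace_orthogonal[OF assms(1,3)] in auto)
  then show ?thesis
    using assms by (simp add: finite_eigenvalues cinner_orth_proj_right[OF subspace_eigenspace])
qed

text \<open>For t > 0 the eigenvalue 0 has power 0 and drops out; Cauchy-Schwarz over the remaining
  eigenvalues produces the cardinality.\<close>

lemma cmod_cinner_normal_power_le:
  assumes "normal_matrix A" "0 < t"
  shows "(cmod (cinner f (normal_power A t g)))\<^sup>2 \<le> card (eigenvalues A - {0}) *
    (\<Sum>z\<in>eigenvalues A - {0}.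
      (cmod (cpow z t))\<^sup>2 * (cmod (cinner (orth_proj (eigenspace A z) f) g))\<^sup>2)"
proof -
  have "cinner f (normal_power A t g)
      = (\<Sum>z\<in>eigenvalues A. cnj (cpow z t) * cinner (orth_proj (eigenspace A z) f) g)"
    by (simp add: normal_power_def cinner_sum_right cinner_scale_right
        cinner_orth_proj_swap[OF subspace_eigenspace])
  also have "\<dots> = (\<Sum>z\<in>eigenvalues A - {0}. cnj (cpow z t) * cinner (orth_proj (eigenspace A z) f) g)"
    by (rule sum.mono_neutral_right) (use assms in \<open>auto simp: finite_eigenvalues cpow_def\<close>)
  finally show ?thesis
    using cmod_sum_squared_le[of "\<lambda>z. cnj (cpow z t) * cinner (orth_proj (eigenspace A z) f) g"
        "eigenvalues A - {0}"]
    by (simp add: norm_mult power_mult_distrib)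
qed

section \<open>Bessel conditions through finite partial sums\<close>

text \<open>An infinite sum of extended nonnegative reals is the supremum of its finite partial
  sums.\<close>

lemma infsum_ennreal_le_iff:
  fixes f :: "'i \<Rightarrow> ennreal"
  shows "infsum f I \<le> b \<longleftrightarrow> (\<forall>F. finite F \<and> F \<subseteq> I \<longrightarrow> sum f F \<le> b)"
  by (subst nonneg_infsum_complete) (auto simp: SUP_le_iff)

lemma infsum_ennreal_le_iff_real:
  fixes f :: "'i \<Rightarrow> real"
  assumes "\<And>i. 0 \<le> f i" "0 \<le> b"
  shows "(\<Sum>\<^sub>\<infinity>i\<in>I. ennreal (f i)) \<le> ennreal b \<longleftrightarrow> (\<forall>F. finite F \<and> F \<subseteq> I \<longrightarrow> sum f F \<le> b)"
  using assms by (simp add: infsum_ennreal_le_iff sum_ennreal)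

lemma bessel_system_iff:
  "bessel_system M I \<phi> \<longleftrightarrow> (\<exists>C>0. \<forall>f\<in>M. \<forall>F. finite F \<and> F \<subseteq> I \<longrightarrow>
    (\<Sum>i\<in>F. (cmod (cinner f (\<phi> i)))\<^sup>2) \<le> C * (norm f)\<^sup>2)"
  unfolding bessel_system_def
  by (intro ex_cong1 conj_cong refl ball_cong) (simp add: infsum_ennreal_le_iff_real)

lemma semicontinuous_bessel_system_iff:
  "semicontinuous_bessel_system M I L \<phi> \<longleftrightarrow> (\<exists>C>0. \<forall>f\<in>M. \<forall>F. finite F \<and> F \<subseteq> I \<longrightarrow>
    (\<Sum>i\<in>F. \<integral>\<^sup>+t\<in>{0..L}. ennreal ((cmod (cinner f (\<phi> i t)))\<^sup>2) \<partial>lborel) \<le> ennreal (C * (norm f)\<^sup>2))"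
  by (simp only: semicontinuous_bessel_system_def infsum_ennreal_le_iff)

lemma nn_integral_const_interval:
  assumes "0 \<le> L" "0 \<le> c"
  shows "(\<integral>\<^sup>+t\<in>{0..L}. ennreal c \<partial>lborel) = ennreal (L * c)"
  using assms by (simp add: nn_integral_cmult_indicator ennreal_mult'' mult.commute)

theorem theorem4p2:
  fixes A :: "complex ^ 'n ^ 'n" and L :: real and G :: "(complex ^ 'n) set"
    and M :: "(complex ^ 'n) set"
  assumes "normal_matrix A"
    and "0 < L"
    and "countable G"
    and "M = range (\<lambda>x. conj_transpose A *v x)"
  shows "semicontinuous_bessel_system UNIV G L (\<lambda>g t. normal_power A t g)
    \<longleftrightarrow> bessel_system M G (orth_proj M)"
proof -
  define \<Lambda> where "\<Lambda> = eigenvalues A - {0}"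
  define P where "P z = orth_proj (eigenspace A z)" for z
  define q where "q z f g = (cmod (cinner (P z f) g))\<^sup>2" for z f g
  let ?I = "\<lambda>f g. \<integral>\<^sup>+t\<in>{0..L}. ennreal ((cmod (cinner f (normal_power A t g)))\<^sup>2) \<partial>lborel"
  let ?spectral = "\<lambda>C. \<forall>z\<in>\<Lambda>. \<forall>f F. finite F \<and> F \<subseteq> G \<longrightarrow> (\<Sum>g\<in>F. q z f g) \<le> C * (norm f)\<^sup>2"

  have q_nonneg: "0 \<le> q z f g" for z f g
    by (simp add: q_def)
  have fin: "finite \<Lambda>"
    using finite_eigenvalues[OF assms(1)] by (simp add: \<Lambda>_def)
  have M: "vec.subspace M"
    unfolding assms(4) by (rule subspace_range_matrix)
  have P_in: "P z f \<in> eigenspace A z" for z f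
    unfolding P_def by (rule orth_proj_in[OF subspace_eigenspace])
  have P_in_M: "P z f \<in> M" if "z \<in> \<Lambda>" for z f
    using subsetD[OF eigenspace_subset_range_adjoint[OF assms(1)] P_in] that
    by (simp add: assms(4) \<Lambda>_def)
  have norm_P: "C * (norm (P z f))\<^sup>2 \<le> C * (norm f)\<^sup>2" if "0 < C" for C z f
    using that norm_orth_proj_le[OF subspace_eigenspace]
    by (intro mult_left_mono power_mono) (auto simp: P_def)
  \<comment> \<open>Vectors of \<open>M\<close> have no component in the kernel of \<open>A\<close>,
    so the nonzero eigenvalues suffice.\<close>
  have decomp: "f = (\<Sum>z\<in>\<Lambda>. P z f)" if "f \<in> M" for f
  proof -
    have "f = (\<Sum>z\<in>eigenvalues A. P z f)"
      using sum_orth_proj_eigenspace[OF assms(1)] by (simp add: P_def)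
    also have "\<dots> = (\<Sum>z\<in>\<Lambda>. P z f)"
      by (rule sum.mono_neutral_right)
        (use that assms(4) in \<open>auto simp: finite_eigenvalues[OF assms(1)] \<Lambda>_def P_def
          orth_proj_kernel_range_adjoint\<close>)
    finally show ?thesis .
  qed

  define B where "B = exp (2 * (L * (\<Sum>z\<in>\<Lambda>. \<bar>ln (cmod z)\<bar>)))"
  have B: "0 < B"
    by (simp add: B_def)
  have cpow: "1 / B \<le> (cmod (cpow z t))\<^sup>2" "(cmod (cpow z t))\<^sup>2 \<le> B"
    if "z \<in> \<Lambda>" "0 \<le> t" "t \<le> L" for z t
    using cmod_cpow_bounds[OF fin that(1) _ that(2,3)] that(1) by (auto simp: B_def \<Lambda>_def)

  \<comment> \<open>Testing with \<open>P z f\<close> isolates the single eigenvalue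
    \<open>z\<close>, whose power has squared modulus at least \<open>1 / B\<close> on the
    interval.\<close>
  have I_lower: "ennreal (L * (1 / B * q z f g)) \<le> ?I (P z f) g" if "z \<in> \<Lambda>" for z f g
  proof -
    have "ennreal (L * (1 / B * q z f g)) = (\<integral>\<^sup>+t\<in>{0..L}. ennreal (1 / B * q z f g) \<partial>lborel)"
      using assms(2) B q_nonneg by (subst nn_integral_const_interval) auto
    also have "\<dots> \<le> ?I (P z f) g"
    proof (rule nn_integral_mono)
      fix t
      show "ennreal (1 / B * q z f g) * indicator {0..L} t
          \<le> ennreal ((cmod (cinner (P z f) (normal_power A t g)))\<^sup>2) * indicator {0..L} t"
      proof (cases "t \<in> {0..L}")
        case True
        then have "1 / B * q z f g \<le> (cmod (cpow z t))\<^sup>2 * q z f g"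
          using cpow that q_nonneg by (intro mult_right_mono) auto
        also have "\<dots> = (cmod (cinner (P z f) (normal_power A t g)))\<^sup>2"
          using that by (simp add: cinner_normal_power_eigenspace[OF assms(1) _ P_in] \<Lambda>_def q_def
              norm_mult power_mult_distrib)
        finally show ?thesis
          using True by (simp add: ennreal_leI)
      qed simp
    qed
    finally show ?thesis .
  qed

  have I_upper: "?I f g \<le> ennreal (L * (card \<Lambda> * (\<Sum>z\<in>\<Lambda>. B * q z f g)))" for f g
  proof -
    have "?I f g \<le> (\<integral>\<^sup>+t\<in>{0..L}. ennreal (card \<Lambda> * (\<Sum>z\<in>\<Lambda>. B * q z f g)) \<partial>lborel)"
    proof (rule nn_integral_mono_AE)
      \<comment> \<open>At t = 0 the kernel of \<open>A\<close> would contribute, since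
        \<open>cpow 0 0\<close> is 1; this single point is discarded as a null set.\<close>
      have "AE t in lborel. t \<noteq> (0::real)"
        by (rule AE_lborel_singleton)
      then show "AE t in lborel. ennreal ((cmod (cinner f (normal_power A t g)))\<^sup>2) * indicator {0..L} t
          \<le> ennreal (card \<Lambda> * (\<Sum>z\<in>\<Lambda>. B * q z f g)) * indicator {0..L} t"
      proof eventually_elim
        fix t :: real assume "t \<noteq> 0"
        show "ennreal ((cmod (cinner f (normal_power A t g)))\<^sup>2) * indicator {0..L} t
          \<le> ennreal (card \<Lambda> * (\<Sum>z\<in>\<Lambda>. B * q z f g)) * indicator {0..L} t"
        proof (cases "t \<in> {0..L}")
          case True
          then have "(cmod (cinner f (normal_power A t g)))\<^sup>2
              \<le> card \<Lambda> * (\<Sum>z\<in>\<Lambda>. (cmod (cpow z t))\<^sup>2 * q z f g)"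
            using cmod_cinner_normal_power_le[OF assms(1)] \<open>t \<noteq> 0\<close> by (simp add: \<Lambda>_def q_def P_def)
          also have "\<dots> \<le> card \<Lambda> * (\<Sum>z\<in>\<Lambda>. B * q z f g)"
            using True by (intro mult_left_mono sum_mono mult_right_mono cpow q_nonneg) auto
          finally show ?thesis
            using True by (simp add: ennreal_leI)
        qed simp
      qed
    qed
    also have "\<dots> = ennreal (L * (card \<Lambda> * (\<Sum>z\<in>\<Lambda>. B * q z f g)))"
      using assms(2) B q_nonneg by (subst nn_integral_const_interval)
        
        
        (auto intro!: mult_nonneg_nonneg sum_nonneg)
    finally show ?thesis .
  qed

  have "(\<exists>C>0. ?spectral C) \<longleftrightarrow> bessel_system M G (orth_proj M)"
  proof
    assume "\<exists>C>0. ?spectral C"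
    then obtain C where C: "0 < C" "?spectral C"
      by blast
    \<comment> \<open>One factor \<open>card \<Lambda>\<close> comes from Cauchy-Schwarz, the other
      from adding the bound over \<open>\<Lambda>\<close>; the added 1 keeps the constant positive
      when \<open>\<Lambda>\<close> is empty.\<close>
    have "(\<Sum>g\<in>F. (cmod (cinner f (orth_proj M g)))\<^sup>2) \<le> (card \<Lambda> * card \<Lambda> + 1) * C * (norm f)\<^sup>2"
      if f: "f \<in> M" and F: "finite F" "F \<subseteq> G" for f F
    proof -
      have "(cmod (cinner f (orth_proj M g)))\<^sup>2 \<le> card \<Lambda> * (\<Sum>z\<in>\<Lambda>. q z f g)" for g
      proof -
        have "cinner f (orth_proj M g) = cinner (\<Sum>z\<in>\<Lambda>. P z f) g"
          using decomp[OF f] by (simp add: cinner_orth_proj_right[OF M f])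
        then show ?thesis
          using cmod_sum_squared_le[of "\<lambda>z. cinner (P z f) g" \<Lambda>]
          by (simp add: cinner_sum_left q_def)
      qed
      then have "(\<Sum>g\<in>F. (cmod (cinner f (orth_proj M g)))\<^sup>2)
          \<le> (\<Sum>g\<in>F. card \<Lambda> * (\<Sum>z\<in>\<Lambda>. q z f g))"
        by (rule sum_mono)
      also have "\<dots> = card \<Lambda> * (\<Sum>z\<in>\<Lambda>. \<Sum>g\<in>F. q z f g)"
        by (simp add: sum_distrib_left sum.swap[of _ F])
      also have "\<dots> \<le> card \<Lambda> * (\<Sum>z\<in>\<Lambda>. C * (norm f)\<^sup>2)"
        using C(2) F by (intro mult_left_mono sum_mono) auto
      also have "\<dots> \<le> (card \<Lambda> * card \<Lambda> + 1) * C * (norm f)\<^sup>2"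
        using C(1) by (simp add: algebra_simps)
      finally show ?thesis .
    qed
    moreover have "0 < (card \<Lambda> * card \<Lambda> + 1) * C"
      using C(1) by (intro mult_pos_pos) (simp_all add: add_pos_nonneg)
    ultimately show "bessel_system M G (orth_proj M)"
      unfolding bessel_system_iff by blast
  next
    assume "bessel_system M G (orth_proj M)"
    then obtain C where C: "0 < C"
      "\<And>f F. f \<in> M \<Longrightarrow> finite F \<and> F \<subseteq> G \<Longrightarrow>
        (\<Sum>g\<in>F. (cmod (cinner f (orth_proj M g)))\<^sup>2) \<le> C * (norm f)\<^sup>2"
      unfolding bessel_system_iff by blast
    \<comment> \<open>The Bessel bound is applied to \<open>P z f\<close>, which lies in
      \<open>M\<close>, so that projecting \<open>g\<close> onto \<open>M\<close> does not change
      the inner product.\<close>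
    have "(\<Sum>g\<in>F. q z f g) \<le> C * (norm f)\<^sup>2" if "z \<in> \<Lambda>" "finite F \<and> F \<subseteq> G" for z f F
    proof -
      have "(\<Sum>g\<in>F. q z f g) = (\<Sum>g\<in>F. (cmod (cinner (P z f) (orth_proj M g)))\<^sup>2)"
        by (simp add: q_def cinner_orth_proj_right[OF M P_in_M[OF that(1)]])
      also have "\<dots> \<le> C * (norm (P z f))\<^sup>2"
        using C(2) P_in_M that by blast
      finally show ?thesis
        using norm_P[OF C(1)] order.trans by blast
    qed
    then show "\<exists>C>0. ?spectral C"
      using C(1) by blast
  qed

  moreover have "(\<exists>C>0. ?spectral C)
    \<longleftrightarrow> semicontinuous_bessel_system UNIV G L (\<lambda>g t. normal_power A t g)"
  proof
    assume "\<exists>C>0. ?spectral C"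
    then obtain C where C: "0 < C" "?spectral C"
      by blast
    \<comment> \<open>The constant of the discrete case, times the length \<open>L\<close> of the
      interval and the upper bound \<open>B\<close> for the squared powers.\<close>
    let ?C = "L * B * (card \<Lambda> * card \<Lambda> + 1) * C"
    have "(\<Sum>g\<in>F. ?I f g) \<le> ennreal (?C * (norm f)\<^sup>2)" if F: "finite F" "F \<subseteq> G" for f F
    proof -
      have "(\<Sum>g\<in>F. ?I f g) \<le> (\<Sum>g\<in>F. ennreal (L * (card \<Lambda> * (\<Sum>z\<in>\<Lambda>. B * q z f g))))"
        by (rule sum_mono) (rule I_upper)
      also have "\<dots> = ennreal (\<Sum>g\<in>F. L * (card \<Lambda> * (\<Sum>z\<in>\<Lambda>. B * q z f g)))"
        using assms(2) B q_nonneg by (intro sum_ennreal mult_nonneg_nonneg sum_nonneg) auto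
      also have "(\<Sum>g\<in>F. L * (card \<Lambda> * (\<Sum>z\<in>\<Lambda>. B * q z f g)))
          = L * B * card \<Lambda> * (\<Sum>z\<in>\<Lambda>. \<Sum>g\<in>F. q z f g)"
        by (simp add: sum_distrib_left sum.swap[of _ F] mult_ac)
      also have "ennreal \<dots> \<le> ennreal (L * B * card \<Lambda> * (\<Sum>z\<in>\<Lambda>. C * (norm f)\<^sup>2))"
        using C(2) F assms(2) B by (intro ennreal_leI mult_left_mono sum_mono) auto
      also have "\<dots> \<le> ennreal (?C * (norm f)\<^sup>2)"
        using C(1) assms(2) B by (intro ennreal_leI) (simp add: algebra_simps)
      finally show ?thesis .
    qed
    moreover have "0 < ?C"
      using C(1) assms(2) B by (intro mult_pos_pos) (simp_all add: add_pos_nonneg)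
    ultimately show "semicontinuous_bessel_system UNIV G L (\<lambda>g t. normal_power A t g)"
      unfolding semicontinuous_bessel_system_iff by blast
  next
    assume "semicontinuous_bessel_system UNIV G L (\<lambda>g t. normal_power A t g)"
    then obtain C where C: "0 < C"
      "\<And>f F. finite F \<and> F \<subseteq> G \<Longrightarrow> (\<Sum>g\<in>F. ?I f g) \<le> ennreal (C * (norm f)\<^sup>2)"
      unfolding semicontinuous_bessel_system_iff by blast
    \<comment> \<open>The Bessel bound is again applied to \<open>P z f\<close>; the factor
      \<open>B / L\<close> undoes the \<open>L / B\<close> of \<open>I_lower\<close>.\<close>
    have "(\<Sum>g\<in>F. q z f g) \<le> B / L * C * (norm f)\<^sup>2"
      if z: "z \<in> \<Lambda>" and F: "finite F \<and> F \<subseteq> G" for z f F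
    proof -
      have "ennreal (\<Sum>g\<in>F. L * (1 / B * q z f g)) = (\<Sum>g\<in>F. ennreal (L * (1 / B * q z f g)))"
        using assms(2) B q_nonneg by (intro sum_ennreal[symmetric] mult_nonneg_nonneg) auto
      also have "\<dots> \<le> (\<Sum>g\<in>F. ?I (P z f) g)"
        by (rule sum_mono) (rule I_lower[OF z])
      also have "\<dots> \<le> ennreal (C * (norm (P z f))\<^sup>2)"
        by (rule C(2)[OF F])
      finally have "(\<Sum>g\<in>F. L * (1 / B * q z f g)) \<le> C * (norm (P z f))\<^sup>2"
        using C(1) by (simp add: ennreal_le_iff)
      also have "\<dots> \<le> C * (norm f)\<^sup>2"
        by (rule norm_P[OF C(1)])
      finally have "L / B * (\<Sum>g\<in>F. q z f g) \<le> C * (norm f)\<^sup>2"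
        by (simp add: sum_distrib_left)
      then show ?thesis
        using assms(2) B by (simp add: field_simps)
    qed
    moreover have "0 < B / L * C"
      using C(1) assms(2) B by simp
    ultimately show "\<exists>C>0. ?spectral C"
      by blast
  qed
  ultimately show ?thesis
    by simp
qed

end
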